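(* Let $E$ be an energy form on $L^0(m)$ and let $h\in D(E)$. The following assertions are equivalent. (i) $h$ is $E$-superharmonic. (ii) There exists $g\in L^0(m)$ with $g\le h$ such that $E(h)=\inf\{E(f): f\in L^0(m)\text{ with }f\ge g\}$. (iii) $E(h)=\inf\{E(f): f\in L^0(m)\text{ with } f\ge h\}$. (iv) For all $f\in L^0(m)$, the inequality $E(f\wedge h)\le E(f)$ holds.
   Context: $(X,\mathcal B,m)$ is a measure space with $m$ localizable: $m$ is semi-finite and every family $\mathcal A\subseteq\mathcal B$ has an essential supremum $S\in\mathcal B$, i.e. $m(A\setminus S)=0$ for all $A\in\mathcal A$, and $m(S\setminus G)=0$ whenever $G\in\mathcal B$ satisfies $m(A\setminus G)=0$ for all $A\in\mathcal A$. $L^0(m)$ is the space of real-valued measurable functions modulo $m$-a.e. equality, with the topology $\tau(m)$ of local convergence in measure: $f_i\to f$ iff $\int_U|f_i-f|\wedge1\,dm\to0$ for every measurable $U$ with $m(U)<\infty$; $f\wedge h=\min\{f,h\}$. A quadratic form on $L^0(m)$ is a map $q:L^0(m)\to[0,\infty]$ with $2q(u)+2q(v)=q(u+v)+q(u-v)$ and $q(\lambda u)=|\lambda|^2q(u)$ ($0\cdot\infty=0$); $D(q)=\{q<\infty\}$, and $q(u,v)=\frac14(q(u+v)-q(u-v))$ is the induced bilinear form on $D(q)$. It is closed if $D(q)$ is complete in the form topology, the smallest topology containing the subspace topology of $\tau(m)$ and the topology of the seminorm $q^{1/2}$. An $\varepsilon$-cutoff is a monotone increasing map $C:\mathbb R\to[-\varepsilon,1+\varepsilon]$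 with $|C(x)-C(y)|\le|x-y|$ and $C(x)=x$ for $x\in[0,1]$. A quadratic form $E$ on $L^0(m)$ is Markovian if for each $\varepsilon>0$ there is an $\varepsilon$-cutoff $C_\varepsilon$ with $E(C_\varepsilon\circ f)\le E(f)$ for all $f\in L^0(m)$; an energy form is a closed Markovian form on $L^0(m)$. A function $h\in D(E)$ is $E$-superharmonic if $E(h,\psi)\ge0$ for all nonnegative $\psi\in D(E)$. *)

theory Defs
  imports "HOL-Analysis.Analysis"
begin

definition semifinite_meas :: "'a measure \<Rightarrow> bool" where
  "semifinite_meas M \<longleftrightarrow>
     (\<forall>A\<in>sets M. emeasure M A = \<infinity> \<longrightarrow>
        (\<exists>B\<in>sets M. B \<subseteq> A \<and> 0 < emeasure M B \<and> emeasure M B < \<infinity>))"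

definition is_ess_sup :: "'a measure \<Rightarrow> 'a set set \<Rightarrow> 'a set \<Rightarrow> bool" where
  "is_ess_sup M \<A> S \<longleftrightarrow> S \<in> sets M \<and>
     (\<forall>A\<in>\<A>. emeasure M (A - S) = 0) \<and>
     (\<forall>G\<in>sets M. (\<forall>A\<in>\<A>. emeasure M (A - G) = 0) \<longrightarrow> emeasure M (S - G) = 0)"

definition localizable :: "'a measure \<Rightarrow> bool" where
  "localizable M \<longleftrightarrow> semifinite_meas M \<and> (\<forall>\<A>\<subseteq>sets M. \<exists>S. is_ess_sup M \<A> S)"

text \<open>
  As usual in the library's integration theory, elements of \<open>L\<^sup>0(m)\<close> are represented by measurable
  functions, i.e. by elements of \<open>borel_measurable M\<close>.  Maps on \<open>L\<^sup>0(m)\<close> are maps on representatives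
  that respect almost everywhere equality, and the order on \<open>L\<^sup>0(m)\<close> is the almost everywhere order.
  The topologies below live on representatives; each of their open sets is saturated with respect
  to almost everywhere equality, so they are the pullbacks of the topologies on the quotient.
\<close>

definition L0_ball :: "'a measure \<Rightarrow> 'a set \<Rightarrow> real \<Rightarrow> ('a \<Rightarrow> real) \<Rightarrow> ('a \<Rightarrow> real) set" where
  "L0_ball M U r f =
     {g \<in> borel_measurable M. (\<integral>\<^sup>+x\<in>U. ennreal (min \<bar>g x - f x\<bar> 1) \<partial>M) < ennreal r}"

text \<open>
  Local convergence in measure: a net converges in this topology iff it converges with respect to each
  of the pseudometrics \<open>\<integral>\<^sub>U \<bar>f - g\<bar> \<and> 1 dm\<close> with \<open>m(U) < \<infinity>\<close>.
\<close>

definition L0_topology :: "'a measure \<Rightarrow> ('a \<Rightarrow> real) topology" where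
  "L0_topology M = topology_generated_by
     {L0_ball M U r f | U r f. U \<in> sets M \<and> emeasure M U < \<infinity> \<and> 0 < r \<and> f \<in> borel_measurable M}"

definition quadratic_form :: "'a measure \<Rightarrow> (('a \<Rightarrow> real) \<Rightarrow> ennreal) \<Rightarrow> bool" where
  "quadratic_form M q \<longleftrightarrow>
     (\<forall>u\<in>borel_measurable M. \<forall>v\<in>borel_measurable M. (AE x in M. u x = v x) \<longrightarrow> q u = q v) \<and>
     (\<forall>u\<in>borel_measurable M. \<forall>v\<in>borel_measurable M.
        2 * q u + 2 * q v = q (\<lambda>x. u x + v x) + q (\<lambda>x. u x - v x)) \<and>
     (\<forall>u\<in>borel_measurable M. \<forall>c::real. q (\<lambda>x. c * u x) = ennreal (\<bar>c\<bar>\<^sup>2) * q u)"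

definition form_dom :: "'a measure \<Rightarrow> (('a \<Rightarrow> real) \<Rightarrow> ennreal) \<Rightarrow> ('a \<Rightarrow> real) set" where
  "form_dom M q = {f \<in> borel_measurable M. q f < \<infinity>}"

text \<open>The induced bilinear form; only meaningful for arguments in the form domain.\<close>

definition form_bilin :: "(('a \<Rightarrow> real) \<Rightarrow> ennreal) \<Rightarrow> ('a \<Rightarrow> real) \<Rightarrow> ('a \<Rightarrow> real) \<Rightarrow> real" where
  "form_bilin q u v =
     (1/4) * (enn2real (q (\<lambda>x. u x + v x)) - enn2real (q (\<lambda>x. u x - v x)))"

definition seminorm_topology ::
    "'a measure \<Rightarrow> (('a \<Rightarrow> real) \<Rightarrow> ennreal) \<Rightarrow> ('a \<Rightarrow> real) topology" where
  "seminorm_topology M q = topology_generated_by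
     {{g \<in> form_dom M q. sqrt (enn2real (q (\<lambda>x. g x - f x))) < r} | f r. f \<in> form_dom M q \<and> 0 < r}"

definition form_topology ::
    "'a measure \<Rightarrow> (('a \<Rightarrow> real) \<Rightarrow> ennreal) \<Rightarrow> ('a \<Rightarrow> real) topology" where
  "form_topology M q = topology_generated_by
     ({S. openin (subtopology (L0_topology M) (form_dom M q)) S} \<union>
      {S. openin (seminorm_topology M q) S})"

text \<open>
  Completeness of a vector space of functions carrying a vector space topology, with respect to
  the translation-invariant uniformity: every Cauchy filter converges.  Sequences do not suffice,
  as \<open>L0_topology\<close> need not be first countable.
\<close>

definition cauchy_filter_in :: "('a \<Rightarrow> real) topology \<Rightarrow> ('a \<Rightarrow> real) filter \<Rightarrow> bool" where
  "cauchy_filter_in T F \<longleftrightarrow> F \<noteq> bot \<and> F \<le> principal (topspace T) \<and>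
     (\<forall>V. openin T V \<and> (\<lambda>x. 0) \<in> V \<longrightarrow>
        (\<exists>A. eventually (\<lambda>f. f \<in> A) F \<and> (\<forall>f\<in>A. \<forall>g\<in>A. (\<lambda>x. f x - g x) \<in> V)))"

definition complete_in :: "('a \<Rightarrow> real) topology \<Rightarrow> bool" where
  "complete_in T \<longleftrightarrow> (\<forall>F. cauchy_filter_in T F \<longrightarrow> (\<exists>f. limitin T (\<lambda>g. g) f F))"

definition closed_form :: "'a measure \<Rightarrow> (('a \<Rightarrow> real) \<Rightarrow> ennreal) \<Rightarrow> bool" where
  "closed_form M q \<longleftrightarrow> quadratic_form M q \<and> complete_in (form_topology M q)"

definition cutoff :: "real \<Rightarrow> (real \<Rightarrow> real) \<Rightarrow> bool" where
  "cutoff \<epsilon> C \<longleftrightarrow> mono C \<and> (\<forall>x. C x \<in> {-\<epsilon>..1 + \<epsilon>}) \<and>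
     (\<forall>x y. \<bar>C x - C y\<bar> \<le> \<bar>x - y\<bar>) \<and> (\<forall>x\<in>{0..1}. C x = x)"

definition markovian :: "'a measure \<Rightarrow> (('a \<Rightarrow> real) \<Rightarrow> ennreal) \<Rightarrow> bool" where
  "markovian M E \<longleftrightarrow> quadratic_form M E \<and>
     (\<forall>\<epsilon>>0. \<exists>C. cutoff \<epsilon> C \<and> (\<forall>f\<in>borel_measurable M. E (C \<circ> f) \<le> E f))"

definition energy_form :: "'a measure \<Rightarrow> (('a \<Rightarrow> real) \<Rightarrow> ennreal) \<Rightarrow> bool" where
  "energy_form M E \<longleftrightarrow> closed_form M E \<and> markovian M E"

definition superharmonic :: "'a measure \<Rightarrow> (('a \<Rightarrow> real) \<Rightarrow> ennreal) \<Rightarrow> ('a \<Rightarrow> real) \<Rightarrow> bool" where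
  "superharmonic M E h \<longleftrightarrow> h \<in> form_dom M E \<and>
     (\<forall>\<psi>\<in>form_dom M E. (AE x in M. 0 \<le> \<psi> x) \<longrightarrow> 0 \<le> form_bilin E h \<psi>)"

end

theory Submission
  imports Defs
begin

text \<open>
  The only implication that uses more than the expansion of \<open>E (h + t \<psi>)\<close> is (i) to (iv). Writing
  \<open>u = f \<and> h\<close> and \<open>p = (f - h)\<^sup>+\<close>, \<open>n = (f - h)\<^sup>-\<close>, one has \<open>f = u + p\<close> and \<open>u = h - n\<close>, so that
  \<open>E f \<ge> E u\<close> follows from \<open>E(u, p) = E(h, p) - E(n, p) \<ge> 0\<close>, once \<open>E(p, n) \<le> 0\<close> is known. The latter
  comes from \<open>E(v\<^sup>+) \<le> E(v)\<close>, applied to \<open>v = p - t n\<close> with \<open>t \<rightarrow> 0\<close>. To obtain \<open>E(v\<^sup>+) \<le> E(v)\<close>,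
  rescaled cutoffs of \<open>v\<close> converge to \<open>v\<^sup>+\<close> with an explicit pointwise error \<open>e\<^sub>n\<close> decreasing
  to 0, and closedness gives the lower semicontinuity needed for such sequences: almost minimizers
  of \<open>E\<close> on the convex sets \<open>{g. \<bar>g - v\<^sup>+\<bar> \<le> e\<^sub>n}\<close> are Cauchy in the form topology.
\<close>

section \<open>Convergence in generated topologies\<close>

text \<open>Eventual membership passes to finite intersections and to supersets, in particular to
  unions, so convergence to \<open>x\<close> has to be tested on generating sets only.\<close>

lemma eventually_mem_generate_topology:
  assumes "generate_topology_on S V" "x \<in> V"
    and "\<And>B. B \<in> S \<Longrightarrow> x \<in> B \<Longrightarrow> eventually (\<lambda>p. y p \<in> B) F"
  shows "eventually (\<lambda>p. y p \<in> V) F"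
  using assms
proof (induction rule: generate_topology_on.induct)
  case Empty
  then show ?case by simp
next
  case (Int a b)
  from Int.prems(1) have "x \<in> a" "x \<in> b" by simp_all
  then show ?case
    using Int.IH(1)[OF _ Int.prems(2)] Int.IH(2)[OF _ Int.prems(2)] by (simp add: eventually_conj)
next
  case (UN K)
  from UN.prems(1) obtain k where k: "k \<in> K" "x \<in> k" by (rule UnionE)
  have "eventually (\<lambda>p. y p \<in> k) F"
    by (rule UN.IH[OF k UN.prems(2)])
  then show ?case by eventually_elim (rule UnionI[OF k(1)])
next
  case (Basis s)
  show ?case by (rule Basis.prems(2)[OF Basis.hyps Basis.prems(1)])
qed

section \<open>Quadratic forms and their bilinear forms\<close>

context
  fixes M :: "'a measure" and q :: "('a \<Rightarrow> real) \<Rightarrow> ennreal"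
  assumes qf: "quadratic_form M q"
begin

private abbreviation (input) "D \<equiv> form_dom M q"
private abbreviation (input) "Q u \<equiv> enn2real (q u)"
private abbreviation (input) "b \<equiv> form_bilin q"

lemma dom_measurable: "u \<in> D \<Longrightarrow> u \<in> borel_measurable M"
  by (simp add: form_dom_def)

lemma dom_finite: "u \<in> D \<Longrightarrow> q u < top"
  by (simp add: form_dom_def)

lemma ennreal_form: "u \<in> D \<Longrightarrow> ennreal (Q u) = q u"
  using dom_finite by simp

lemma parallelogram_ennreal:
  "u \<in> borel_measurable M \<Longrightarrow> v \<in> borel_measurable M \<Longrightarrow>
     2 * q u + 2 * q v = q (\<lambda>x. u x + v x) + q (\<lambda>x. u x - v x)"
  using qf unfolding quadratic_form_def by blast

lemma form_scale_ennreal: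
  "u \<in> borel_measurable M \<Longrightarrow> q (\<lambda>x. c * u x) = ennreal (c\<^sup>2) * q u"
  using qf unfolding quadratic_form_def power2_abs by blast

lemma form_cong_AE:
  "u \<in> borel_measurable M \<Longrightarrow> v \<in> borel_measurable M \<Longrightarrow> AE x in M. u x = v x \<Longrightarrow> q u = q v"
  using qf unfolding quadratic_form_def by blast

text \<open>The parallelogram identity makes the sum of both values finite, hence each of
  them.\<close>

lemma dom_add_diff:
  assumes "u \<in> D" "v \<in> D"
  shows "(\<lambda>x. u x + v x) \<in> D" "(\<lambda>x. u x - v x) \<in> D"
proof -
  have m: "u \<in> borel_measurable M" "v \<in> borel_measurable M"
    using dom_measurable[OF assms(1)] dom_measurable[OF assms(2)] by blast+
  have "2 * q u + 2 * q v < top"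
    using dom_finite[OF assms(1)] dom_finite[OF assms(2)] by (simp add: ennreal_mult_less_top)
  then have "q (\<lambda>x. u x + v x) + q (\<lambda>x. u x - v x) < top"
    unfolding parallelogram_ennreal[OF m] .
  then have "q (\<lambda>x. u x + v x) < \<infinity>" "q (\<lambda>x. u x - v x) < \<infinity>"
    by simp_all
  then show "(\<lambda>x. u x + v x) \<in> D" "(\<lambda>x. u x - v x) \<in> D"
    using m by (simp_all add: form_dom_def)
qed

lemma dom_scale: "u \<in> D \<Longrightarrow> (\<lambda>x. c * u x) \<in> D"
  using form_scale_ennreal[of u c] by (auto simp: form_dom_def ennreal_mult_less_top)

lemma form_scale: "u \<in> D \<Longrightarrow> Q (\<lambda>x. c * u x) = c\<^sup>2 * Q u"
  using form_scale_ennreal[of u c] dom_measurable[of u] by (simp add: enn2real_mult)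

lemma parallelogram:
  assumes "u \<in> D" "v \<in> D"
  shows "Q (\<lambda>x. u x + v x) + Q (\<lambda>x. u x - v x) = 2 * Q u + 2 * Q v"
proof -
  have "enn2real (2 * q u + 2 * q v) = enn2real (q (\<lambda>x. u x + v x) + q (\<lambda>x. u x - v x))"
    using assms dom_measurable parallelogram_ennreal by simp
  moreover have "enn2real (2 * q u + 2 * q v) = 2 * Q u + 2 * Q v"
    using assms dom_finite by (subst enn2real_plus) (auto simp: ennreal_mult_less_top enn2real_mult)
  moreover have "enn2real (q (\<lambda>x. u x + v x) + q (\<lambda>x. u x - v x)) =
      Q (\<lambda>x. u x + v x) + Q (\<lambda>x. u x - v x)"
    using dom_add_diff[OF assms] dom_finite by (intro enn2real_plus) auto
  ultimately show ?thesis by simp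
qed

lemma form_add_diff_expand:
  assumes "u \<in> D" "v \<in> D"
  shows "Q (\<lambda>x. u x + v x) = Q u + Q v + 2 * b u v"
    and "Q (\<lambda>x. u x - v x) = Q u + Q v - 2 * b u v"
  using parallelogram[OF assms] by (simp_all add: form_bilin_def field_simps)

text \<open>Jordan-von Neumann argument: the first plus the third minus the second parallelogram
  identity eliminates the mixed values at \<open>u + v - w\<close> and \<open>u - v + w\<close> and
  leaves twice the value at \<open>u + v + w\<close>.\<close>

lemma bilin_add:
  assumes "u \<in> D" "v \<in> D" "w \<in> D"
  shows "b u (\<lambda>x. v x + w x) = b u v + b u w"
proof -
  have 1: "Q (\<lambda>x. u x + v x + w x) + Q (\<lambda>x. u x + v x - w x) = 2 * Q (\<lambda>x. u x + v x) + 2 * Q w"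
    using parallelogram[OF dom_add_diff(1)[OF assms(1,2)] assms(3)] .
  have 2: "Q (\<lambda>x. u x + v x - w x) + Q (\<lambda>x. u x - v x + w x) = 2 * Q u + 2 * Q (\<lambda>x. v x - w x)"
    using parallelogram[OF assms(1) dom_add_diff(2)[OF assms(2,3)]] by (simp add: algebra_simps)
  have 3: "Q (\<lambda>x. u x + v x + w x) + Q (\<lambda>x. u x - v x + w x) = 2 * Q (\<lambda>x. u x + w x) + 2 * Q v"
    using parallelogram[OF dom_add_diff(1)[OF assms(1,3)] assms(2)] by (simp add: algebra_simps)
  have 4: "Q (\<lambda>x. u x + v x + w x) = Q u + Q (\<lambda>x. v x + w x) + 2 * b u (\<lambda>x. v x + w x)"
    using form_add_diff_expand(1)[OF assms(1) dom_add_diff(1)[OF assms(2,3)]] by (simp add: algebra_simps)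
  show ?thesis
    using 1 2 3 4 parallelogram[OF assms(2,3)] form_add_diff_expand(1)[OF assms(1,2)] form_add_diff_expand(1)[OF assms(1,3)]
    by linarith
qed

lemma bilin_commute:
  assumes "u \<in> D" "v \<in> D"
  shows "b u v = b v u"
  using form_add_diff_expand(1)[OF assms] form_add_diff_expand(1)[OF assms(2,1)] by (simp add: add.commute)

lemma bilin_diff:
  assumes "u \<in> D" "v \<in> D" "w \<in> D"
  shows "b u (\<lambda>x. v x - w x) = b u v - b u w"
  using bilin_add[OF assms(1) dom_add_diff(2)[OF assms(2,3)] assms(3)] by simp

lemma bilin_of_nat:
  assumes "u \<in> D" "v \<in> D"
  shows "b u (\<lambda>x. real n * v x) = real n * b u v"
proof (induction n)
  case 0
  show ?case by (simp add: form_bilin_def)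
next
  case (Suc n)
  have "(\<lambda>x. real (Suc n) * v x) = (\<lambda>x. real n * v x + v x)"
    by (simp add: algebra_simps)
  then have "b u (\<lambda>x. real (Suc n) * v x) = b u (\<lambda>x. real n * v x) + b u v"
    using bilin_add[OF assms(1) dom_scale[OF assms(2)] assms(2)] by simp
  then show ?case using Suc by (simp add: algebra_simps)
qed

text \<open>Follows by applying \<open>bilin_of_nat\<close> to \<open>v\<close> divided by
  \<open>n + 1\<close>. These scalars suffice for letting a step size tend to 0.\<close>

lemma bilin_inverse_of_nat:
  assumes "u \<in> D" "v \<in> D"
  shows "b u (\<lambda>x. inverse (real (Suc n)) * v x) = inverse (real (Suc n)) * b u v"
  using bilin_of_nat[OF assms(1) dom_scale[OF assms(2)], of "Suc n" "inverse (real (Suc n))"]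
  by (simp add: field_simps del: of_nat_Suc)

text \<open>A substitute for the Cauchy--Schwarz inequality that needs no real homogeneity of the bilinear
  form: for \<open>n\<close> large and then \<open>v\<close> small, the right-hand side is small.\<close>

lemma bilin_abs_le:
  assumes "u \<in> D" "v \<in> D"
  shows "2 * \<bar>b u v\<bar> \<le> Q u / real (Suc n) + real (Suc n) * Q v"
proof -
  let ?n = "real (Suc n)"
  have d: "(\<lambda>x. ?n * v x) \<in> D" using dom_scale assms by blast
  \<comment> \<open>These are the expansions of \<open>Q\<close> at \<open>u + ?n v\<close> and
    \<open>u - ?n v\<close>, both nonnegative.\<close>
  have "0 \<le> Q u + ?n\<^sup>2 * Q v + 2 * (?n * b u v)" "0 \<le> Q u + ?n\<^sup>2 * Q v - 2 * (?n * b u v)"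
    using form_add_diff_expand[OF assms(1) d] form_scale[OF assms(2), of ?n] bilin_of_nat[OF assms, of "Suc n"]
      enn2real_nonneg by metis+
  then have "?n * (2 * \<bar>b u v\<bar>) \<le> Q u + ?n\<^sup>2 * Q v"
    by (cases "b u v \<ge> 0") auto
  also have "\<dots> = ?n * (Q u / ?n + ?n * Q v)"
    by (simp add: field_simps power2_eq_square del: of_nat_Suc)
  finally show ?thesis by (simp del: of_nat_Suc)
qed

text \<open>First variation: \<open>Q (u + t v) - Q u = 2 t b u v + t^2 Q v\<close> is nonnegative;
  divide by \<open>t\<close> and let \<open>t\<close> run through
  \<open>1 / (n + 1)\<close>.\<close>

lemma bilin_nonneg_if_minimal:
  assumes "u \<in> D" "v \<in> D"
    and min: "\<And>t. t > 0 \<Longrightarrow> q u \<le> q (\<lambda>x. u x + t * v x)"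
  shows "0 \<le> b u v"
proof -
  have "- (inverse (real (Suc n)) * Q v) \<le> 2 * b u v" for n
  proof -
    let ?t = "inverse (real (Suc n))"
    have d: "(\<lambda>x. ?t * v x) \<in> D" using dom_scale assms by blast
    have "Q u \<le> Q (\<lambda>x. u x + ?t * v x)"
      using min[of ?t] dom_finite[OF dom_add_diff(1)[OF assms(1) d]] by (simp add: enn2real_mono)
    also have "\<dots> = Q u + ?t\<^sup>2 * Q v + 2 * (?t * b u v)"
      using form_add_diff_expand(1)[OF assms(1) d] form_scale[OF assms(2)] bilin_inverse_of_nat[OF assms(1,2), of n]
      by simp
    finally have "0 \<le> ?t * (?t * Q v + 2 * b u v)"
      by (simp add: algebra_simps power2_eq_square)
    then have "0 \<le> ?t * Q v + 2 * b u v"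
      by (simp add: zero_le_mult_iff del: of_nat_Suc)
    then show ?thesis by simp
  qed
  moreover have "(\<lambda>n. - (inverse (real (Suc n)) * Q v)) \<longlonglongrightarrow> - (0 * Q v)"
    by (intro tendsto_intros LIMSEQ_inverse_real_of_nat)
  ultimately have "- (0 * Q v) \<le> 2 * b u v"
    by (intro LIMSEQ_le_const2) auto
  then show ?thesis by simp
qed

lemma form_continuous:
  assumes "u \<in> D" and d: "\<And>p. d p \<in> D" and lim: "((\<lambda>p. Q (d p)) \<longlongrightarrow> 0) F"
  shows "((\<lambda>p. Q (\<lambda>x. u x + d p x)) \<longlongrightarrow> Q u) F"
proof -
  have "((\<lambda>p. b u (d p)) \<longlongrightarrow> 0) F"
  proof (rule tendstoI)
    fix e :: real assume "e > 0"
    \<comment> \<open>The index \<open>n\<close> is fixed first, to push one summand of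
      \<open>bilin_abs_le\<close> below \<open>e\<close>; the other one then follows from
      \<open>Q (d p)\<close> tending to 0. The factor 2 in that bound absorbs the sum of
      both.\<close>
    have "(\<lambda>n. Q u / real (Suc n)) \<longlonglongrightarrow> 0"
      using LIMSEQ_Suc[OF lim_const_over_n] .
    then have "eventually (\<lambda>n. Q u / real (Suc n) < e) sequentially"
      using \<open>e > 0\<close> by (rule order_tendstoD)
    then obtain n where n: "Q u / real (Suc n) < e"
      by (auto simp: eventually_sequentially)
    have "((\<lambda>p. real (Suc n) * Q (d p)) \<longlongrightarrow> real (Suc n) * 0) F"
      by (intro tendsto_intros lim)
    then have "eventually (\<lambda>p. real (Suc n) * Q (d p) < e) F"
      using \<open>e > 0\<close> by (intro order_tendstoD(2)) auto
    then show "eventually (\<lambda>p. dist (b u (d p)) 0 < e) F"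
    proof eventually_elim
      case (elim p)
      then show ?case using bilin_abs_le[OF assms(1) d, of p n] n by simp
    qed
  qed
  then have "((\<lambda>p. Q u + Q (d p) + 2 * b u (d p)) \<longlongrightarrow> Q u + 0 + 2 * 0) F"
    by (intro tendsto_intros lim)
  then show ?thesis using form_add_diff_expand(1)[OF assms(1) d] by simp
qed

section \<open>Convergence to zero in the form topology\<close>

lemma topspace_form_topology: "topspace (form_topology M q) = D"
proof
  have "topspace (seminorm_topology M q) \<subseteq> D"
    unfolding seminorm_topology_def topology_generated_by_topspace by auto
  then have "S \<subseteq> D" if "openin (seminorm_topology M q) S" for S
    using openin_subset[OF that] by auto
  then show "topspace (form_topology M q) \<subseteq> D"
    unfolding form_topology_def topology_generated_by_topspace
    by (auto simp: openin_subtopology)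
next
  show "D \<subseteq> topspace (form_topology M q)"
  proof
    fix f assume f: "f \<in> D"
    let ?S = "{g \<in> D. sqrt (Q (\<lambda>x. g x - f x)) < 1}"
    have "openin (seminorm_topology M q) ?S"
      unfolding seminorm_topology_def using f
      by (intro topology_generated_by_Basis CollectI exI[of _ f] exI[of _ 1]) auto
    then have "openin (form_topology M q) ?S"
      unfolding form_topology_def by (intro topology_generated_by_Basis) auto
    moreover have "f \<in> ?S" using f form_scale[OF f, of 0] by simp
    ultimately show "f \<in> topspace (form_topology M q)"
      using openin_subset by blast
  qed
qed

text \<open>The form topology is generated by the open sets of two topologies that are themselves
  generated, so the test on generating sets is made at two levels. The balls at the lower level have
  arbitrary centres, not only 0.\<close>

lemma eventually_mem_form_topology:
  assumes y: "\<And>p. y p \<in> D"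
    and Q: "((\<lambda>p. Q (y p)) \<longlongrightarrow> 0) F"
    and I: "\<And>U. U \<in> sets M \<Longrightarrow> emeasure M U < \<infinity> \<Longrightarrow>
              ((\<lambda>p. \<integral>\<^sup>+x\<in>U. ennreal (min \<bar>y p x\<bar> 1) \<partial>M) \<longlongrightarrow> 0) F"
    and V: "openin (form_topology M q) V" "(\<lambda>x. 0) \<in> V"
  shows "eventually (\<lambda>p. y p \<in> V) F"
proof (rule eventually_mem_generate_topology[OF _ V(2)])
  show "generate_topology_on ({S. openin (subtopology (L0_topology M) D) S} \<union>
      {S. openin (seminorm_topology M q) S}) V"
    using V(1) unfolding form_topology_def openin_topology_generated_by_iff .
next
  fix B assume B: "B \<in> {S. openin (subtopology (L0_topology M) D) S} \<union>
      {S. openin (seminorm_topology M q) S}" and 0: "(\<lambda>x. 0) \<in> B"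
  from B consider T where "openin (L0_topology M) T" "B = T \<inter> D" | "openin (seminorm_topology M q) B"
    by (auto simp: openin_subtopology)
  then show "eventually (\<lambda>p. y p \<in> B) F"
  proof cases
    case 1
    have "eventually (\<lambda>p. y p \<in> T) F"
    proof (rule eventually_mem_generate_topology)
      show "generate_topology_on {L0_ball M U r f |U r f. U \<in> sets M \<and> emeasure M U < \<infinity> \<and>
          0 < r \<and> f \<in> borel_measurable M} T"
        using 1(1) unfolding L0_topology_def openin_topology_generated_by_iff .
      show "(\<lambda>x. 0) \<in> T" using 0 1 by auto
    next
      fix A assume "A \<in> {L0_ball M U r f |U r f. U \<in> sets M \<and> emeasure M U < \<infinity> \<and>
          0 < r \<and> f \<in> borel_measurable M}" and A0: "(\<lambda>x. 0) \<in> A"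
      then obtain U r f where A: "A = L0_ball M U r f" and U: "U \<in> sets M" "emeasure M U < \<infinity>"
        and f: "f \<in> borel_measurable M" by blast
      let ?c = "\<integral>\<^sup>+x\<in>U. ennreal (min \<bar>f x\<bar> 1) \<partial>M"
      let ?I = "\<lambda>p. \<integral>\<^sup>+x\<in>U. ennreal (min \<bar>y p x\<bar> 1) \<partial>M"
      have c: "?c < ennreal r" using A0 A by (simp add: L0_ball_def)
      have ym: "y p \<in> borel_measurable M" for p using y dom_measurable by blast
      note [measurable] = f ym U(1)
      \<comment> \<open>The ball is centred at \<open>f\<close>; the truncated triangle inequality
        leaves \<open>?c\<close>, which is strictly below \<open>r\<close>, plus a term tending to
        0.\<close>
      have le: "(\<integral>\<^sup>+x\<in>U. ennreal (min \<bar>y p x - f x\<bar> 1) \<partial>M) \<le> ?c + ?I p" for p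
      proof -
        have "(\<integral>\<^sup>+x\<in>U. ennreal (min \<bar>y p x - f x\<bar> 1) \<partial>M) \<le>
            (\<integral>\<^sup>+x. ennreal (min \<bar>f x\<bar> 1) * indicator U x + ennreal (min \<bar>y p x\<bar> 1) * indicator U x \<partial>M)"
          by (intro nn_integral_mono)
             (auto simp: indicator_def ennreal_plus[symmetric] simp del: ennreal_plus intro!: ennreal_leI)
        also have "\<dots> = ?c + ?I p"
          by (intro nn_integral_add) measurable
        finally show ?thesis .
      qed
      have "((\<lambda>p. ?c + ?I p) \<longlongrightarrow> ?c + 0) F"
        by (intro tendsto_intros I U)
      then have "eventually (\<lambda>p. ?c + ?I p < ennreal r) F"
        using c by (intro order_tendstoD(2)) auto
      then show "eventually (\<lambda>p. y p \<in> A) F"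
        by eventually_elim (use le ym A in \<open>auto simp: L0_ball_def intro: le_less_trans\<close>)
    qed
    then show ?thesis using y 1 by simp
  next
    case 2
    show ?thesis
    proof (rule eventually_mem_generate_topology[OF _ 0])
      show "generate_topology_on
          {{g \<in> D. sqrt (Q (\<lambda>x. g x - f x)) < r} | f r. f \<in> D \<and> 0 < r} B"
        using 2 unfolding seminorm_topology_def openin_topology_generated_by_iff .
    next
      fix A assume "A \<in> {{g \<in> D. sqrt (Q (\<lambda>x. g x - f x)) < r} | f r. f \<in> D \<and> 0 < r}"
        and A0: "(\<lambda>x. 0) \<in> A"
      then obtain f r where A: "A = {g \<in> D. sqrt (Q (\<lambda>x. g x - f x)) < r}" and f: "f \<in> D"
        by blast
      have nf: "(\<lambda>x. - f x) \<in> D" using dom_scale[OF f, of "-1"] by simp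
      \<comment> \<open>The centre \<open>f\<close> is handled by continuity of \<open>Q\<close> at
        \<open>- f\<close>, since \<open>y p - f\<close> is \<open>- f\<close> plus a perturbation
        that is small in the form.\<close>
      have "((\<lambda>p. sqrt (Q (\<lambda>x. - f x + y p x))) \<longlongrightarrow> sqrt (Q (\<lambda>x. - f x))) F"
        by (intro tendsto_intros form_continuous nf y Q)
      then have "eventually (\<lambda>p. sqrt (Q (\<lambda>x. - f x + y p x)) < r) F"
        using A0 A by (intro order_tendstoD(2)) auto
      then show "eventually (\<lambda>p. y p \<in> A) F"
        by eventually_elim (use y A in simp)
    qed
  qed
qed

section \<open>Lower semicontinuity from closedness\<close>

text \<open>The functions \<open>s n\<close> make each constraint set nonempty and keep its infimum
  at most \<open>C\<close>. As the sets shrink, the infima increase to a finite limit, so near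
  minimizers with slack \<open>1 / (n + 1)\<close> have asymptotically equal values, which forces
  them together.\<close>

lemma near_minimizers_cauchy:
  assumes e_dec: "\<And>x. antimono (\<lambda>n. e n x)"
    and s: "\<And>n. s n \<in> D" "\<And>n x. \<bar>s n x - f x\<bar> \<le> e n x" "\<And>n. Q (s n) \<le> C"
  obtains G where "\<And>n. G n \<in> D" "\<And>n x. \<bar>G n x - f x\<bar> \<le> e n x"
    "\<And>n. Q (G n) \<le> C + inverse (real (Suc n))"
    "((\<lambda>p. Q (\<lambda>x. G (fst p) x - G (snd p) x)) \<longlongrightarrow> 0) (sequentially \<times>\<^sub>F sequentially)"
proof -
  text \<open>Each \<open>K n\<close> is convex, so that elements of \<open>K n\<close> almost minimizing \<open>Q\<close> are close to each
    other by the parallelogram identity.\<close>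
  define K where "K n = {g \<in> D. \<forall>x. \<bar>g x - f x\<bar> \<le> e n x}" for n
  define d where "d n = Inf (Q ` K n)" for n
  have bdd: "bdd_below (Q ` K n)" for n by (intro bdd_belowI[of _ 0]) auto
  have sK: "s n \<in> K n" for n using s by (simp add: K_def)
  have K_anti: "K n \<subseteq> K m" if "m \<le> n" for m n
    using antimonoD[OF e_dec that] by (fastforce simp: K_def intro: order_trans)
  have d_le: "d n \<le> Q g" if "g \<in> K n" for n g
    unfolding d_def using that bdd by (intro cInf_lower) auto
  have d_C: "d n \<le> C" for n using d_le[OF sK] s(3) order_trans by blast
  have "incseq d"
    unfolding d_def by (intro monoI cInf_superset_mono bdd image_mono K_anti) (use sK in auto)
  then obtain L where L: "d \<longlonglongrightarrow> L" and dL: "\<And>n. d n \<le> L"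
    using incseq_convergent d_C by blast
  have "\<exists>g\<in>K n. Q g < d n + inverse (real (Suc n))" for n
    using cInf_lessD[of "Q ` K n" "d n + inverse (real (Suc n))"] sK[of n]
    by (auto simp: d_def)
  then obtain G where G: "\<And>n. G n \<in> K n" and GQ: "\<And>n. Q (G n) < d n + inverse (real (Suc n))"
    by metis
  have GD: "G n \<in> D" for n using G by (auto simp: K_def)
  \<comment> \<open>The midpoint of \<open>G m\<close> and \<open>G n\<close> lies in
    \<open>K N\<close>, so \<open>Q (G m + G n)\<close> is at least \<open>4 * d N\<close>. The
    parallelogram identity subtracts this from \<open>2 * Q (G m) + 2 * Q (G n)\<close>, which is at
    most \<open>4 * L\<close> plus slack.\<close>
  have bound: "Q (\<lambda>x. G m x - G n x) \<le> 4 * (L - d N) + 4 * inverse (real (Suc N))"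
    if "N \<le> m" "N \<le> n" for m n N
  proof -
    let ?a = "\<lambda>x. (1/2) * (G m x + G n x)"
    have "?a \<in> K N"
    proof -
      have "\<bar>?a x - f x\<bar> \<le> e N x" for x
      proof -
        have "\<bar>G m x - f x\<bar> \<le> e N x" "\<bar>G n x - f x\<bar> \<le> e N x"
          using G[of m] K_anti[OF that(1)] G[of n] K_anti[OF that(2)] by (auto simp: K_def)
        then show ?thesis by (simp add: abs_le_iff field_simps)
      qed
      moreover have "?a \<in> D" by (intro dom_scale dom_add_diff GD)
      ultimately show ?thesis by (simp add: K_def)
    qed
    then have "4 * d N \<le> 4 * Q ?a" using d_le by simp
    also have "\<dots> = Q (\<lambda>x. G m x + G n x)"
      using form_scale[OF dom_add_diff(1)[OF GD[of m] GD[of n]], of "1/2"] by (simp add: power2_eq_square)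
    finally have "4 * d N \<le> Q (\<lambda>x. G m x + G n x)" .
    moreover have "inverse (real (Suc m)) \<le> inverse (real (Suc N))"
      "inverse (real (Suc n)) \<le> inverse (real (Suc N))" using that by simp_all
    moreover have "Q (G m) \<le> L + inverse (real (Suc m))" "Q (G n) \<le> L + inverse (real (Suc n))"
      using GQ[of m] GQ[of n] dL[of m] dL[of n] by linarith+
    ultimately show ?thesis
      using parallelogram[OF GD[of m] GD[of n]] by (simp only: right_diff_distrib)
  qed
  have "((\<lambda>p. Q (\<lambda>x. G (fst p) x - G (snd p) x)) \<longlongrightarrow> 0) (sequentially \<times>\<^sub>F sequentially)"
  proof (rule tendstoI)
    fix r :: real assume "r > 0"
    have "(\<lambda>N. 4 * (L - d N) + 4 * inverse (real (Suc N))) \<longlonglongrightarrow> 4 * (L - L) + 4 * 0"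
      by (intro tendsto_intros L LIMSEQ_inverse_real_of_nat)
    then have "eventually (\<lambda>N. 4 * (L - d N) + 4 * inverse (real (Suc N)) < r) sequentially"
      using \<open>r > 0\<close> by (intro order_tendstoD(2)) auto
    then obtain N where "4 * (L - d N) + 4 * inverse (real (Suc N)) < r"
      by (auto simp: eventually_sequentially)
    then show "eventually (\<lambda>p. dist (Q (\<lambda>x. G (fst p) x - G (snd p) x)) 0 < r)
        (sequentially \<times>\<^sub>F sequentially)"
      unfolding eventually_prod_sequentially
      using bound by (auto intro!: exI[of _ N] intro: le_less_trans)
  qed
  moreover have "Q (G n) \<le> C + inverse (real (Suc n))" for n
    using GQ[of n] d_C[of n] by linarith
  moreover have "\<bar>G n x - f x\<bar> \<le> e n x" for n x using G by (auto simp: K_def)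
  ultimately show ?thesis using that GD by blast
qed

end

text \<open>Dominated convergence: truncation at 1 gives the majorant \<open>indicator U\<close>,
  integrable because \<open>U\<close> has finite measure.\<close>

lemma min_nn_integral_tendsto_0:
  fixes e :: "nat \<Rightarrow> 'a \<Rightarrow> real"
  assumes [measurable]: "\<And>n. e n \<in> borel_measurable M" "U \<in> sets M"
    and U: "emeasure M U < \<infinity>" and lim: "\<And>x. (\<lambda>n. e n x) \<longlonglongrightarrow> 0"
  shows "(\<lambda>n. \<integral>\<^sup>+x\<in>U. ennreal (min (e n x) 1) \<partial>M) \<longlonglongrightarrow> 0"
proof -
  have "(\<lambda>n. \<integral>\<^sup>+x\<in>U. ennreal (min (e n x) 1) \<partial>M) \<longlonglongrightarrow> (\<integral>\<^sup>+x. 0 \<partial>M)"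
  proof (rule nn_integral_dominated_convergence[where w = "indicator U"])
    show "(\<integral>\<^sup>+x. indicator U x \<partial>M) < \<infinity>" using U by simp
    show "AE x in M. (\<lambda>n. ennreal (min (e n x) 1) * indicator U x) \<longlonglongrightarrow> 0"
    proof (rule AE_I2)
      fix x
      have "(\<lambda>n. ennreal (min (e n x) 1) * indicator U x) \<longlonglongrightarrow> ennreal (min 0 1) * indicator U x"
        by (intro tendsto_intros lim) (auto simp: indicator_def)
      then show "(\<lambda>n. ennreal (min (e n x) 1) * indicator U x) \<longlonglongrightarrow> 0" by simp
    qed
    show "AE x in M. ennreal (min (e n x) 1) * indicator U x \<le> indicator U x" for n
      by (rule AE_I2) (simp split: split_indicator)
  qed auto
  then show ?thesis by simp
qed

text \<open>The integrand is positive where \<open>f\<close> and \<open>g\<close> differ, so every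
  measurable subset of that set with finite measure is null; semi-finiteness then excludes that the
  set itself has infinite measure.\<close>

lemma semifinite_AE_eq:
  fixes f g :: "'a \<Rightarrow> real"
  assumes sf: "semifinite_meas M"
    and [measurable]: "f \<in> borel_measurable M" "g \<in> borel_measurable M"
    and I: "\<And>U. U \<in> sets M \<Longrightarrow> emeasure M U < \<infinity> \<Longrightarrow>
        (\<integral>\<^sup>+x\<in>U. ennreal (min \<bar>g x - f x\<bar> 1) \<partial>M) = 0"
  shows "AE x in M. f x = g x"
proof -
  let ?N = "{x \<in> space M. f x \<noteq> g x}"
  have null: "emeasure M U = 0" if U: "U \<in> sets M" "emeasure M U < \<infinity>" "U \<subseteq> ?N" for U
  proof -
    note [measurable] = U(1)
    have "AE x in M. ennreal (min \<bar>g x - f x\<bar> 1) * indicator U x = 0"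
      using I[OF U(1,2)] by (subst (asm) nn_integral_0_iff_AE) auto
    then have ae: "AE x in M. x \<notin> U"
      by eventually_elim (use U(3) in \<open>auto simp: indicator_def min_def split: if_splits\<close>)
    have "{x \<in> space M. \<not> x \<notin> U} = U" using U(3) by auto
    from AE_iff_measurable[OF U(1) this] ae show ?thesis by blast
  qed
  have "emeasure M ?N = 0"
  proof (cases "emeasure M ?N = \<infinity>")
    case True
    moreover have "?N \<in> sets M" by measurable
    ultimately obtain B where "B \<in> sets M" "B \<subseteq> ?N" "0 < emeasure M B" "emeasure M B < \<infinity>"
      using sf unfolding semifinite_meas_def by blast
    then show ?thesis using null[of B] by simp
  next
    case False
    then show ?thesis by (intro null) (auto simp: less_top)
  qed
  then show ?thesis by (subst AE_iff_measurable[of ?N]) auto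
qed

text \<open>The sequence \<open>s\<close> need not be Cauchy in the form topology, so it is replaced
  by near minimizers \<open>G\<close> inside the same envelope \<open>e\<close>. Completeness gives
  a limit \<open>g\<close> with \<open>q g \<le> c\<close>, and the envelope forces
  \<open>g = f\<close> almost everywhere.\<close>

lemma closed_form_le_of_dominated_limit:
  fixes f :: "'a \<Rightarrow> real"
  assumes sf: "semifinite_meas M" and cl: "closed_form M q"
    and f[measurable]: "f \<in> borel_measurable M"
    and e[measurable]: "\<And>n. e n \<in> borel_measurable M"
    and e_dec: "\<And>x. antimono (\<lambda>n. e n x)" and e_lim: "\<And>x. (\<lambda>n. e n x) \<longlonglongrightarrow> 0"
    and s: "\<And>n. s n \<in> borel_measurable M" "\<And>n x. \<bar>s n x - f x\<bar> \<le> e n x" "\<And>n. q (s n) \<le> c"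
    and c: "c < top"
  shows "q f \<le> c"
proof -
  let ?T = "form_topology M q" and ?Q = "\<lambda>u. enn2real (q u)" and ?D = "form_dom M q"
  have qf: "quadratic_form M q" and compl: "complete_in ?T" using cl by (auto simp: closed_form_def)
  have sD: "s n \<in> ?D" and sQ: "?Q (s n) \<le> enn2real c" for n
    using s(1,3) c le_less_trans[OF s(3) c] by (auto simp: enn2real_mono form_dom_def)
  obtain G where
    GD: "\<And>n. G n \<in> ?D" and Ge: "\<And>n x. \<bar>G n x - f x\<bar> \<le> e n x"
    and GQ: "\<And>n. ?Q (G n) \<le> enn2real c + inverse (real (Suc n))"
    and GC: "((\<lambda>p. ?Q (\<lambda>x. G (fst p) x - G (snd p) x)) \<longlongrightarrow> 0) (sequentially \<times>\<^sub>F sequentially)"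
    by (rule near_minimizers_cauchy[OF qf, where e = e and s = s and f = f, OF e_dec sD s(2) sQ]) (rule that)
  have Gm[measurable]: "G n \<in> borel_measurable M" for n using GD dom_measurable[OF qf] by blast
  have D_diff: "(\<lambda>x. G m x - G n x) \<in> ?D" for m n using dom_add_diff(2)[OF qf] GD by blast
  \<comment> \<open>From index \<open>N\<close> on all functions stay within \<open>e N\<close> of
    \<open>f\<close>, so their mutual distance is at most \<open>2 * e N\<close>, whose truncated
    integral tends to 0.\<close>
  have cauchy_int: "((\<lambda>p. \<integral>\<^sup>+x\<in>U. ennreal (min \<bar>G (fst p) x - G (snd p) x\<bar> 1) \<partial>M) \<longlongrightarrow> 0)
      (sequentially \<times>\<^sub>F sequentially)" if U[measurable]: "U \<in> sets M" "emeasure M U < \<infinity>" for U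
  proof -
    have "(\<lambda>n. 2 * e n x) \<longlonglongrightarrow> 0" for x using tendsto_mult_right_zero[OF e_lim] .
    then have lim: "(\<lambda>N. \<integral>\<^sup>+x\<in>U. ennreal (min (2 * e N x) 1) \<partial>M) \<longlonglongrightarrow> 0"
      by (intro min_nn_integral_tendsto_0 U) auto
    have le: "\<bar>G m x - G n x\<bar> \<le> 2 * e N x" if "N \<le> m" "N \<le> n" for m n N x
      using Ge[of m x] Ge[of n x] antimonoD[OF e_dec that(1), of x] antimonoD[OF e_dec that(2), of x]
      by linarith
    show ?thesis
    proof (rule order_tendstoI)
      fix a :: ennreal assume "0 < a"
      then have "eventually (\<lambda>N. (\<integral>\<^sup>+x\<in>U. ennreal (min (2 * e N x) 1) \<partial>M) < a) sequentially"
        by (rule order_tendstoD(2)[OF lim])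
      then obtain N where N: "(\<integral>\<^sup>+x\<in>U. ennreal (min (2 * e N x) 1) \<partial>M) < a"
        by (auto simp: eventually_sequentially)
      have "(\<integral>\<^sup>+x\<in>U. ennreal (min \<bar>G m x - G n x\<bar> 1) \<partial>M) < a" if "N \<le> m" "N \<le> n" for m n
        using N by (rule le_less_trans[rotated])
          (intro nn_integral_mono mult_right_mono ennreal_leI min.mono le that order_refl; simp)
      then show "eventually (\<lambda>p. (\<integral>\<^sup>+x\<in>U. ennreal (min \<bar>G (fst p) x - G (snd p) x\<bar> 1) \<partial>M) < a)
          (sequentially \<times>\<^sub>F sequentially)"
        unfolding eventually_prod_sequentially by auto
    qed auto
  qed
  \<comment> \<open>Completeness speaks of filters; the sequence enters through the filter generated
    by its tails.\<close>
  have "cauchy_filter_in ?T (filtermap G sequentially)"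
    unfolding cauchy_filter_in_def
  proof (intro conjI allI impI)
    show "filtermap G sequentially \<noteq> bot" by (simp add: filtermap_bot_iff)
    show "filtermap G sequentially \<le> principal (topspace ?T)"
      by (simp add: topspace_form_topology[OF qf] le_principal eventually_filtermap GD)
    fix V assume V: "openin ?T V \<and> (\<lambda>x. 0) \<in> V"
    have "eventually (\<lambda>p. (\<lambda>x. G (fst p) x - G (snd p) x) \<in> V) (sequentially \<times>\<^sub>F sequentially)"
      using V GC by (intro eventually_mem_form_topology[OF qf] cauchy_int)
        (simp_all add: D_diff)
    then obtain N where N: "\<And>m n. N \<le> m \<Longrightarrow> N \<le> n \<Longrightarrow> (\<lambda>x. G m x - G n x) \<in> V"
      unfolding eventually_prod_sequentially by auto
    show "\<exists>A. eventually (\<lambda>f. f \<in> A) (filtermap G sequentially) \<and> (\<forall>f\<in>A. \<forall>g\<in>A. (\<lambda>x. f x - g x) \<in> V)"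
      by (rule exI[of _ "G ` {N..}"])
        (use N in \<open>auto simp: eventually_filtermap eventually_sequentially intro!: exI[of _ N]\<close>)
  qed
  then obtain g where g: "limitin ?T (\<lambda>g. g) g (filtermap G sequentially)"
    using compl unfolding complete_in_def by blast
  have gD: "g \<in> ?D" using limitin_topspace[OF g] topspace_form_topology[OF qf] by simp
  have gm[measurable]: "g \<in> borel_measurable M" using gD dom_measurable[OF qf] by blast
  have ev: "eventually (\<lambda>n. G n \<in> V) sequentially" if "openin ?T V" "g \<in> V" for V
    using g that unfolding limitin_def eventually_filtermap by blast
  have "(\<lambda>n. ?Q (\<lambda>x. G n x - g x)) \<longlonglongrightarrow> 0"
  proof (rule order_tendstoI)
    fix r :: real assume r: "0 < r"
    \<comment> \<open>The radius is \<open>sqrt r\<close> because the seminorm is the square root of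
      the form.\<close>
    let ?V = "{k \<in> ?D. sqrt (?Q (\<lambda>x. k x - g x)) < sqrt r}"
    have "openin (seminorm_topology M q) ?V"
      unfolding seminorm_topology_def using gD r
      by (intro topology_generated_by_Basis CollectI exI[of _ g] exI[of _ "sqrt r"]) auto
    then have "openin ?T ?V"
      unfolding form_topology_def by (intro topology_generated_by_Basis) auto
    moreover have "g \<in> ?V" using gD r form_scale[OF qf gD, of 0] by simp
    ultimately show "eventually (\<lambda>n. ?Q (\<lambda>x. G n x - g x) < r) sequentially"
      by (rule eventually_mono[OF ev]) simp
  qed (auto intro!: always_eventually intro: less_le_trans)
  \<comment> \<open>Writing \<open>G n\<close> as \<open>g\<close> plus a perturbation turns
    convergence in the seminorm into convergence of the values of the form.\<close>
  then have "(\<lambda>n. ?Q (\<lambda>x. g x + (G n x - g x))) \<longlonglongrightarrow> ?Q g"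
    by (intro form_continuous[OF qf gD] dom_add_diff(2)[OF qf] GD gD)
  then have "(\<lambda>n. ?Q (G n)) \<longlonglongrightarrow> ?Q g" by simp
  moreover have "(\<lambda>n. enn2real c + inverse (real (Suc n))) \<longlonglongrightarrow> enn2real c + 0"
    by (intro tendsto_intros LIMSEQ_inverse_real_of_nat)
  ultimately have "?Q g \<le> enn2real c + 0"
    using GQ by (intro LIMSEQ_le) auto
  then have "q g \<le> c"
    using ennreal_form[OF qf gD] c ennreal_leI by fastforce
  \<comment> \<open>For a common index \<open>n\<close>, \<open>G n\<close> is close to
    \<open>g\<close> by convergence in the form topology and close to \<open>f\<close> by the
    envelope, so the truncated integral of \<open>g - f\<close> is below every positive
    bound.\<close>
  moreover have "AE x in M. f x = g x"
  proof (rule semifinite_AE_eq[OF sf])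
    fix U assume U[measurable]: "U \<in> sets M" and Uf: "emeasure M U < \<infinity>"
    let ?I = "\<lambda>u. \<integral>\<^sup>+x\<in>U. ennreal (min \<bar>u x\<bar> 1) \<partial>M"
    have "?I (\<lambda>x. g x - f x) < ennreal r + ennreal r" if r: "0 < r" for r
    proof -
      have "openin (L0_topology M) (L0_ball M U r g)"
        unfolding L0_topology_def using U Uf r gm by (intro topology_generated_by_Basis) blast
      then have "openin ?T (L0_ball M U r g \<inter> ?D)"
        unfolding form_topology_def by (intro topology_generated_by_Basis) (auto simp: openin_subtopology)
      moreover have "g \<in> L0_ball M U r g \<inter> ?D" using gD gm r by (simp add: L0_ball_def)
      ultimately have "eventually (\<lambda>n. ?I (\<lambda>x. G n x - g x) < ennreal r) sequentially"
        by (rule eventually_mono[OF ev]) (simp add: L0_ball_def)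
      moreover have "(\<lambda>n. \<integral>\<^sup>+x\<in>U. ennreal (min (e n x) 1) \<partial>M) \<longlonglongrightarrow> 0"
        by (intro min_nn_integral_tendsto_0 U Uf e_lim) auto
      then have "eventually (\<lambda>n. (\<integral>\<^sup>+x\<in>U. ennreal (min (e n x) 1) \<partial>M) < ennreal r) sequentially"
        using r by (intro order_tendstoD(2)) auto
      ultimately obtain n where n: "?I (\<lambda>x. G n x - g x) < ennreal r"
        "(\<integral>\<^sup>+x\<in>U. ennreal (min (e n x) 1) \<partial>M) < ennreal r"
        using eventually_happens'[OF sequentially_bot eventually_conj] by blast
      have e0: "0 \<le> e n x" for x using Ge[of n x] by linarith
      have min: "min \<bar>g x - f x\<bar> 1 \<le> min \<bar>G n x - g x\<bar> 1 + min (e n x) 1" for x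
        using Ge[of n x] by linarith
      have "?I (\<lambda>x. g x - f x) \<le> (\<integral>\<^sup>+x. ennreal (min \<bar>G n x - g x\<bar> 1) * indicator U x +
          ennreal (min (e n x) 1) * indicator U x \<partial>M)"
        using min e0 by (intro nn_integral_mono)
          (auto simp: indicator_def ennreal_plus[symmetric] simp del: ennreal_plus intro!: ennreal_leI)
      also have "\<dots> = ?I (\<lambda>x. G n x - g x) + (\<integral>\<^sup>+x\<in>U. ennreal (min (e n x) 1) \<partial>M)"
        by (intro nn_integral_add) measurable
      also have "\<dots> < ennreal r + ennreal r"
        using n by (rule add_strict_mono)
      finally show ?thesis .
    qed
    note small = this
    have "?I (\<lambda>x. g x - f x) \<le> 0 + ennreal r" if "0 < r" for r
      using small[of "r / 2"] \<open>0 < r\<close> by (simp flip: ennreal_plus)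
    then show "?I (\<lambda>x. g x - f x) = 0"
      using ennreal_le_epsilon[of 0 "?I (\<lambda>x. g x - f x)"] by simp
  qed (use f gm in auto)
  ultimately show ?thesis using form_cong_AE[OF qf f gm] by simp
qed

section \<open>Energy forms and positive parts\<close>

lemma form_le_add:
  assumes qf: "quadratic_form M q" and D: "u \<in> form_dom M q" "w \<in> form_dom M q"
    and "0 \<le> form_bilin q u w"
  shows "q u \<le> q (\<lambda>x. u x + w x)"
proof -
  have "enn2real (q u) \<le> enn2real (q (\<lambda>x. u x + w x))"
    using form_add_diff_expand(1)[OF qf D] assms(4) by simp
  then show ?thesis
    using ennreal_form[OF qf D(1)] ennreal_form[OF qf dom_add_diff(1)[OF qf D]] ennreal_leI by metis
qed

text \<open>The rescaled cutoff is exact on \<open>[0, k]\<close>. Below 0 it lies between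
  \<open>- k * inverse (k^2) = - inverse k\<close> and 0, which explains the choice of the cutoff
  parameter; above \<open>k\<close>, monotonicity and the Lipschitz bound place it between
  \<open>k\<close> and \<open>y\<close>.\<close>

lemma cutoff_scaled_bound:
  assumes C: "cutoff (inverse (k\<^sup>2)) C" and k: "0 < k"
  shows "\<bar>k * C (y / k) - max y 0\<bar> \<le> inverse k + max 0 (y - k)"
proof -
  have mono: "mono C" and low: "- inverse (k\<^sup>2) \<le> C (y / k)"
    and lip: "\<And>x z. \<bar>C x - C z\<bar> \<le> \<bar>x - z\<bar>" and id: "\<And>x. 0 \<le> x \<Longrightarrow> x \<le> 1 \<Longrightarrow> C x = x"
    using C by (auto simp: cutoff_def)
  have C01: "C 0 = 0" "C 1 = 1" using id by auto
  consider "y \<le> 0" | "0 \<le> y" "y \<le> k" | "k \<le> y" by linarith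
  then show ?thesis
  proof cases
    case 1
    have "y / k \<le> 0" using 1 k by (simp add: divide_le_0_iff)
    then have "k * C (y / k) \<le> 0"
      using monoD[OF mono, of "y / k" 0] C01 k by (simp add: mult_le_0_iff)
    moreover have "k * - inverse (k\<^sup>2) \<le> k * C (y / k)"
      using low k by (intro mult_left_mono) auto
    moreover have "k * - inverse (k\<^sup>2) = - inverse k"
      using k by (simp add: power2_eq_square)
    ultimately show ?thesis using 1 k by simp
  next
    case 2
    then show ?thesis using id[of "y / k"] k by simp
  next
    case 3
    have "1 \<le> y / k" using 3 k by simp
    then have "1 \<le> C (y / k)" "C (y / k) \<le> y / k"
      using monoD[OF mono, of 1 "y / k"] C01 lip[of "y / k" 1] by auto
    then have "k \<le> k * C (y / k)" "k * C (y / k) \<le> y"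
      using k by (auto simp: field_simps)
    moreover have "0 < inverse k" using k by simp
    ultimately show ?thesis using 3 k by linarith
  qed
qed

text \<open>By quadratic homogeneity the Markov inequality survives conjugating the cutoff with
  scaling by \<open>k\<close>, and the conjugated cutoffs tend to the positive part as
  \<open>k\<close> grows.\<close>

lemma energy_form_pos_part_le:
  fixes f :: "'a \<Rightarrow> real"
  assumes sf: "semifinite_meas M" and E: "energy_form M E"
    and f[measurable]: "f \<in> borel_measurable M"
  shows "E (\<lambda>x. max (f x) 0) \<le> E f"
proof (cases "E f = top")
  case False
  have cl: "closed_form M E" and qf: "quadratic_form M E" and mk: "markovian M E"
    using E by (auto simp: energy_form_def markovian_def)
  define k where "k n = real (Suc n)" for n
  have k: "0 < k n" for n by (simp add: k_def)
  have "\<exists>C. cutoff (inverse ((k n)\<^sup>2)) C \<and> (\<forall>g\<in>borel_measurable M. E (C \<circ> g) \<le> E g)" for n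
  proof -
    have "0 < inverse ((k n)\<^sup>2)" using k[of n] by simp
    then show ?thesis using mk unfolding markovian_def by blast
  qed
  then obtain C where C: "\<And>n. cutoff (inverse ((k n)\<^sup>2)) (C n)"
    and EC: "\<And>n g. g \<in> borel_measurable M \<Longrightarrow> E (C n \<circ> g) \<le> E g"
    by metis
  have [measurable]: "C n \<in> borel_measurable borel" for n
    using C[of n] by (intro borel_measurable_mono) (simp add: cutoff_def)
  define s where "s n = (\<lambda>x. k n * C n (f x / k n))" for n
  define e where "e n = (\<lambda>x. inverse (k n) + max 0 (f x - k n))" for n
  show ?thesis
  proof (rule closed_form_le_of_dominated_limit[OF sf cl, where e = e and s = s])
    show "(\<lambda>x. max (f x) 0) \<in> borel_measurable M" by measurable
    show "e n \<in> borel_measurable M" for n unfolding e_def by measurable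
    show "s n \<in> borel_measurable M" for n unfolding s_def by measurable
    show "antimono (\<lambda>n. e n x)" for x
      unfolding e_def by (intro antimonoI add_mono max.mono) (auto simp: k_def le_imp_inverse_le)
    show "(\<lambda>n. e n x) \<longlonglongrightarrow> 0" for x
    proof -
      obtain N where N: "f x < real N" using reals_Archimedean2 by blast
      \<comment> \<open>Once \<open>k n\<close> exceeds \<open>f x\<close>, this part of the error
        is exactly 0.\<close>
      have "(\<lambda>n. max 0 (f x - k n)) \<longlonglongrightarrow> 0"
      proof (rule tendsto_eventually)
        show "eventually (\<lambda>n. max 0 (f x - k n) = 0) sequentially"
          using eventually_ge_at_top[of N] by eventually_elim (use N in \<open>auto simp: k_def\<close>)
      qed
      then have "(\<lambda>n. e n x) \<longlonglongrightarrow> 0 + 0"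
        unfolding e_def using LIMSEQ_inverse_real_of_nat by (intro tendsto_add) (simp_all add: k_def)
      then show ?thesis by simp
    qed
    show "\<bar>s n x - max (f x) 0\<bar> \<le> e n x" for n x
      unfolding s_def e_def by (rule cutoff_scaled_bound[OF C k])
    show "E (s n) \<le> E f" for n
    proof -
      let ?g = "\<lambda>x. f x / k n"
      have g: "?g \<in> borel_measurable M" "C n \<circ> ?g \<in> borel_measurable M"
        unfolding comp_def by measurable
      have "E (s n) = ennreal ((k n)\<^sup>2) * E (C n \<circ> ?g)"
        using form_scale_ennreal[OF qf g(2), of "k n"] by (simp add: s_def comp_def)
      also have "\<dots> \<le> ennreal ((k n)\<^sup>2) * E ?g"
        by (intro mult_left_mono EC g(1)) simp
      also have "\<dots> = E f"
        using form_scale_ennreal[OF qf g(1), of "k n"] k[of n] by simp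
      finally show ?thesis .
    qed
    show "E f < top" using False by (simp add: less_top)
  qed
qed simp

text \<open>Since \<open>p\<close> and \<open>n\<close> are never both nonzero,
  \<open>p - t n\<close> has positive part \<open>p\<close> for every \<open>t > 0\<close>. Thus
  \<open>E\<close> is minimal at \<open>p\<close> in the direction \<open>- n\<close>, and the first
  variation there is nonnegative.\<close>

lemma energy_form_bilin_pos_neg_part:
  fixes v :: "'a \<Rightarrow> real"
  assumes sf: "semifinite_meas M" and E: "energy_form M E" and v: "v \<in> form_dom M E"
  defines "p \<equiv> \<lambda>x. max (v x) 0" and "n \<equiv> \<lambda>x. max (- v x) 0"
  shows "p \<in> form_dom M E" "n \<in> form_dom M E" "form_bilin E p n \<le> 0"
proof -
  have qf: "quadratic_form M E" using E by (auto simp: energy_form_def markovian_def)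
  have pos: "(\<lambda>x. max (u x) 0) \<in> form_dom M E" if "u \<in> form_dom M E" for u
    using that energy_form_pos_part_le[OF sf E, of u]
    by (auto simp: form_dom_def intro: le_less_trans)
  have neg: "(\<lambda>x. - u x) \<in> form_dom M E" if "u \<in> form_dom M E" for u
    using dom_scale[OF qf that, of "-1"] by simp
  show p: "p \<in> form_dom M E" and n: "n \<in> form_dom M E"
    unfolding p_def n_def using pos v neg by auto
  have "0 \<le> form_bilin E p (\<lambda>x. - n x)"
  proof (rule bilin_nonneg_if_minimal[OF qf p neg[OF n]])
    fix t :: real assume "0 < t"
    then have "(\<lambda>x. max (p x + t * - n x) 0) = p"
      by (auto simp: p_def n_def fun_eq_iff max_def mult_le_0_iff zero_le_mult_iff)
    moreover have "(\<lambda>x. p x + t * - n x) \<in> form_dom M E"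
      using dom_add_diff(1)[OF qf p dom_scale[OF qf neg[OF n]]] .
    ultimately show "E p \<le> E (\<lambda>x. p x + t * - n x)"
      using energy_form_pos_part_le[OF sf E dom_measurable[OF qf], of "\<lambda>x. p x + t * - n x"] by simp
  qed
  \<comment> \<open>Negating the second argument swaps the two terms of the polarization formula and
    so changes the sign.\<close>
  then show "form_bilin E p n \<le> 0" by (simp add: form_bilin_def)
qed

section \<open>Superharmonic functions\<close>

lemma superharmonic_min_le:
  fixes f h :: "'a \<Rightarrow> real"
  assumes sf: "semifinite_meas M" and E: "energy_form M E" and sh: "superharmonic M E h"
    and f: "f \<in> borel_measurable M"
  shows "E (\<lambda>x. min (f x) (h x)) \<le> E f"
proof (cases "E f = top")
  case False
  have qf: "quadratic_form M E" using E by (auto simp: energy_form_def markovian_def)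
  have fD: "f \<in> form_dom M E" using f False by (simp add: form_dom_def less_top)
  have hD: "h \<in> form_dom M E" using sh by (simp add: superharmonic_def)
  let ?u = "\<lambda>x. min (f x) (h x)"
  let ?p = "\<lambda>x. max (f x - h x) 0" and ?n = "\<lambda>x. max (- (f x - h x)) 0"
  \<comment> \<open>The choice \<open>v = f - h\<close> puts both parts into the domain and gives
    the sign of their mixed term.\<close>
  note pn = energy_form_bilin_pos_neg_part[OF sf E dom_add_diff(2)[OF qf fD hD]]
  have u: "(\<lambda>x. h x - ?n x) = ?u" by (auto simp: fun_eq_iff)
  have uD: "?u \<in> form_dom M E" using dom_add_diff(2)[OF qf hD pn(2)] unfolding u .
  \<comment> \<open>Here \<open>?u = h - ?n\<close> stands in the second argument, where
    \<open>bilin_diff\<close> applies; symmetry moves it back afterwards.\<close>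
  have "form_bilin E ?p ?u = form_bilin E ?p h - form_bilin E ?p ?n"
    using bilin_diff[OF qf pn(1) hD pn(2)] unfolding u .
  moreover have "0 \<le> form_bilin E h ?p"
    using sh pn(1) unfolding superharmonic_def by auto
  ultimately have "0 \<le> form_bilin E ?u ?p"
    using pn(3) bilin_commute[OF qf pn(1) hD] bilin_commute[OF qf pn(1) uD] by linarith
  from form_le_add[OF qf uD pn(1) this] have "E ?u \<le> E (\<lambda>x. ?u x + ?p x)" .
  also have "(\<lambda>x. ?u x + ?p x) = f" by (auto simp: fun_eq_iff)
  finally show ?thesis .
qed simp

theorem theorem2p52:
  fixes M :: "'a measure" and E :: "('a \<Rightarrow> real) \<Rightarrow> ennreal" and h :: "'a \<Rightarrow> real"
  assumes "localizable M"
    and "energy_form M E"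
    and "h \<in> form_dom M E"
  shows
    "(superharmonic M E h \<longleftrightarrow>
        (\<exists>g\<in>borel_measurable M. (AE x in M. g x \<le> h x) \<and>
           E h = Inf (E ` {f \<in> borel_measurable M. AE x in M. g x \<le> f x}))) \<and>
     (superharmonic M E h \<longleftrightarrow>
        E h = Inf (E ` {f \<in> borel_measurable M. AE x in M. h x \<le> f x})) \<and>
     (superharmonic M E h \<longleftrightarrow>
        (\<forall>f\<in>borel_measurable M. E (\<lambda>x. min (f x) (h x)) \<le> E f))"
proof -
  let ?S = "superharmonic M E h"
  let ?A = "\<lambda>g. {f \<in> borel_measurable M. AE x in M. g x \<le> f x}"
  let ?ii = "\<exists>g\<in>borel_measurable M. (AE x in M. g x \<le> h x) \<and> E h = Inf (E ` ?A g)"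
  let ?iii = "E h = Inf (E ` ?A h)"
  let ?iv = "\<forall>f\<in>borel_measurable M. E (\<lambda>x. min (f x) (h x)) \<le> E f"
  have sf: "semifinite_meas M" using assms(1) by (simp add: localizable_def)
  have qf: "quadratic_form M E" using assms(2) by (auto simp: energy_form_def markovian_def)
  have hm: "h \<in> borel_measurable M" using dom_measurable[OF qf assms(3)] .
  \<comment> \<open>The implications run in the cycle (i), (iv), (iii), (ii), (i).\<close>
  have i_iv: ?iv if ?S
    using superharmonic_min_le[OF sf assms(2) that] by blast
  have iv_iii: ?iii if iv: ?iv
  proof (rule antisym)
    show "E h \<le> Inf (E ` ?A h)"
    proof (rule INF_greatest)
      fix f assume f: "f \<in> ?A h"
      then have fm: "f \<in> borel_measurable M" by simp
      \<comment> \<open>As \<open>f\<close> is above \<open>h\<close> almost everywhere, the minimum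
        is \<open>h\<close> up to a null set.\<close>
      have "E h = E (\<lambda>x. min (f x) (h x))"
        using f hm by (intro form_cong_AE[OF qf]) (auto elim!: eventually_mono)
      also have "\<dots> \<le> E f" using iv fm by blast
      finally show "E h \<le> E f" .
    qed
    show "Inf (E ` ?A h) \<le> E h" using hm by (intro INF_lower) simp
  qed
  \<comment> \<open>The witness is \<open>g = h\<close>.\<close>
  have iii_ii: ?ii if ?iii using that hm by blast
  have ii_i: ?S if ii: ?ii
    unfolding superharmonic_def
  proof (intro conjI ballI impI assms(3))
    fix \<psi> assume \<psi>: "\<psi> \<in> form_dom M E" and \<psi>0: "AE x in M. 0 \<le> \<psi> x"
    obtain g where g: "AE x in M. g x \<le> h x" "E h = Inf (E ` ?A g)" using ii by blast
    show "0 \<le> form_bilin E h \<psi>"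
    \<comment> \<open>For \<open>t > 0\<close> the function \<open>h + t * \<psi>\<close> stays
      above \<open>g\<close>, so it competes in the infimum that equals \<open>E h\<close>; hence
      \<open>h\<close> is minimal in the direction \<open>\<psi>\<close>.\<close>
    proof (rule bilin_nonneg_if_minimal[OF qf assms(3) \<psi>])
      fix t :: real assume "0 < t"
      have "AE x in M. g x \<le> h x + t * \<psi> x"
        using g(1) \<psi>0
      proof eventually_elim
        case (elim x)
        have "0 \<le> t * \<psi> x" using elim(2) \<open>0 < t\<close> by simp
        then show ?case using elim(1) by linarith
      qed
      moreover have "(\<lambda>x. h x + t * \<psi> x) \<in> borel_measurable M"
        using dom_measurable[OF qf dom_add_diff(1)[OF qf assms(3) dom_scale[OF qf \<psi>]]] .
      ultimately show "E h \<le> E (\<lambda>x. h x + t * \<psi> x)"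
        unfolding g(2) by (intro INF_lower) simp
    qed
  qed
  show ?thesis using i_iv iv_iii iii_ii ii_i by blast
qed

end
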